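(* Let $N_s,N_t,N_\mu$ be positive integers, let $X_{s,s}\in\mathbb{R}^{N_s\times N_s}$ be a symmetric positive definite matrix (representing a norm on a finite-dimensional subspace of a Hilbert space), and let $H\in\mathbb{R}^{N_s\times N_s}$ be its upper-triangular Cholesky factor, $H^TH=X_{s,s}$. Let $\delta>0$ be the time-step size and let $X_{st,st}$ be the block-diagonal matrix with $N_t$ diagonal blocks, each equal to $\delta X_{s,s}$. Let $U\in\mathbb{R}^{N_s\times N_t\times N_\mu}$ be a snapshot tensor, with matricizations $U_{s,t\mu}\in\mathbb{R}^{N_s\times N_tN_\mu}$ and $U_{st,\mu}\in\mathbb{R}^{N_sN_t\times N_\mu}$, and let $\widetilde U$ be the rescaled tensor defined by $\widetilde U_{s,t\mu}=HU_{s,t\mu}$. (1) Let $\widetilde T_s=\widetilde U_{s,t\mu}$ and $\widetilde T_t\in\mathbb{R}^{r_sN_t\times N_\mu}$ be the spatial and temporal unfoldings, and $\widetilde\Phi_s\in\mathbb{R}^{N_s\times r_s}$, $\widetilde\Phi_t\in\mathbb{R}^{r_sN_t\times r_t}$ the cores, of the TT-SVD of $\widetilde U$, viewed as a tensor with axes $(s,t,\mu)$, with given ranks $(r_s,r_t)$. Let the corresponding relative errors be $\widetilde\varepsilon_s,\widetilde\varepsilon_t$, i.e. $\|\widetilde T_s-\widetilde\Phi_s\widetilde R_s\|_F^2=\widetilde\varepsilon_s^2\|\widetilde T_s\|_F^2$ and $\|\widetilde T_t-\widetilde\Phi_t\widetilde R_t\|_F^2=\widetilde\varepsilon_t^2\|\widetilde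 T_t\|_F^2$, where $\widetilde R_s,\widetilde R_t$ are the remainders. Define $\Phi_s=H^{-1}\widetilde\Phi_s$, $\Phi_t=\widetilde\Phi_t$, and let $\Phi\in\mathbb{R}^{N_sN_t\times r_t}$ be the contraction of the cores $\Phi_s$ and $\Phi_t$. Then $$\sum_{j=1}^{N_\mu}\big\|\big(U_{st,\mu}-\Phi\Phi^TX_{st,st}U_{st,\mu}\big)[:,j]\big\|_{X_{st,st}}^2\le(\widetilde\varepsilon_s^2+\widetilde\varepsilon_t^2)\,\|U_{st,\mu}\|_{X_{st,st}}^2 .$$ (2) Moreover, suppose $\widetilde U$ admits a split-axes representation, i.e. $N_s=N_1\cdots N_d$ and $\widetilde U$ is identified with a tensor in $\mathbb{R}^{N_1\times\cdots\times N_d\times N_{d+1}\times N_\mu}$, $N_{d+1}=N_t$. Let $\widetilde T_i$, $\widetilde\Phi_i$, $\widetilde R_i$ ($i=1,\dots,d+1$) be the unfoldings, cores and remainders of its TT-SVD with given ranks $r_1,\dots,r_{d+1}$ and relative errors $\widetilde\varepsilon_i$, i.e. $\|\widetilde T_i-\widetilde\Phi_i\widetilde R_i\|_F^2=\widetilde\varepsilon_i^2\|\widetilde T_i\|_F^2$. Let $\widetilde\Phi\in\mathbb{R}^{N_sN_t\times r_{d+1}}$ be the contraction of $\widetilde\Phi_1,\dots,\widetilde\Phi_{d+1}$, and let $\Phi$ be obtained from $\widetilde\Phi$ by applying $H^{-1}$ along the (merged) spatial axis. Then $$\sum_{j=1}^{N_\mu}\big\|\big(U_{st,\mu}-\Phi\Phi^TX_{st,st}U_{st,\mu}\big)[:,j]\big\|_{X_{st,st}}^2\le\sum_{i=1}^{d+1}\widetilde\varepsilon_i^2\|\widetilde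 T_i\|_F^2\le\widetilde\varepsilon^2(d+1)\|U_{st,\mu}\|_{X_{st,st}}^2,\qquad\widetilde\varepsilon=\sup_i\widetilde\varepsilon_i .$$
   Context: Reshaping convention: axes of a tensor may be merged or split without changing the entries, with a fixed consistent ordering of merged indices; $X_{st,st}$ acts as $\delta X_{s,s}$ on the spatial index and as the identity on the temporal index. The time-step size is $\delta=T/N_t$ for a uniform partition of the time interval $[0,T]$ into $N_t$ steps. For a symmetric positive definite $X$, $\|v\|_X^2=v^TXv$; for a matrix $A$ with columns $A[:,j]$, $\|A\|_X^2=\sum_j\|A[:,j]\|_X^2$. $\|\cdot\|_F$ is the Frobenius norm. TT-SVD of a tensor $W\in\mathbb{R}^{M_1\times\cdots\times M_k\times N_\mu}$ with ranks $\rho_1,\dots,\rho_k$ (and $\rho_0=1$): set $T_1\in\mathbb{R}^{M_1\times(M_2\cdots M_kN_\mu)}$ to be the unfolding of $W$ with its first axis as row index. For $i=1,\dots,k$, compute a rank-$\rho_i$ truncated singular value decomposition of $T_i$: the core $\Phi_i\in\mathbb{R}^{\rho_{i-1}M_i\times\rho_i}$ has as columns the leading $\rho_i$ orthonormal left singular vectors, and the remainder $R_i=\Sigma_iV_i^T=\Phi_i^TT_i$ is the product of the corresponding singular values and right singular vectors. For $i<k$, $T_{i+1}$ is the reshaping of $R_i\in\mathbb{R}^{\rho_i\times(M_{i+1}\cdots M_kN_\mu)}$ to a matrix of size $(\rho_iM_{i+1})\times(M_{i+2}\cdots M_kN_\mu)$. In part (1), $k=2$ with $(M_1,M_2)=(N_s,N_t)$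 and $(\rho_1,\rho_2)=(r_s,r_t)$; in part (2), $k=d+1$ with $M_i=N_i$ and $\rho_i=r_i$. Contraction of cores: identifying $\Phi_i$ with a three-dimensional array $\Phi_i[\alpha_{i-1},n_i,\alpha_i]$ of size $\rho_{i-1}\times M_i\times\rho_i$, the contraction of $\Phi_1,\dots,\Phi_k$ is the matrix $$\Phi[(n_1,\dots,n_k),\alpha_k]=\sum_{\alpha_1,\dots,\alpha_{k-1}}\Phi_1[1,n_1,\alpha_1]\,\Phi_2[\alpha_1,n_2,\alpha_2]\cdots\Phi_k[\alpha_{k-1},n_k,\alpha_k].$$
   Formalization: The printed bounds fail for δ≠1 (all sizes, X, H, U equal to 1: left side δ(1−δ)²>0, right side 0). They are proved as printed for δ=1; for every δ>0 with δ⁻¹ΦΦᵀX_{st,st} in place of ΦΦᵀX_{st,st} and, in (2), δ times the middle sum. Relative errors are taken nonnegative. *)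

theory Defs
  imports
    "Jordan_Normal_Form.Matrix"
    "Jordan_Normal_Form.Gauss_Jordan_Elimination"
    "HOL-Library.FuncSet"
begin

(* A real tensor of shape [M_1, ..., M_k] is a function on index lists [n_1, ..., n_k],
   indices starting at 0. Only the entries with n_i < M_i are ever read. *)

type_synonym tensor = "nat list \<Rightarrow> real"

(* Merged indices are ordered with the first axis varying fastest: over the shape
   [M_1, ..., M_k], the tuple [n_1, ..., n_k] has the merged index
   n_1 + M_1 * (n_2 + M_2 * (n_3 + ...)), and split_idx recovers the tuple.
   With this ordering the space-time weight matrix is block diagonal with one
   spatial block per time step. *)

fun split_idx :: "nat list \<Rightarrow> nat \<Rightarrow> nat list" where
  "split_idx [] k = []"
| "split_idx (M # Ms) k = (k mod M) # split_idx Ms (k div M)"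

(* The first q axes are merged into the row index, the others into the column index. *)

definition matricize :: "nat \<Rightarrow> nat list \<Rightarrow> tensor \<Rightarrow> real mat" where
  "matricize q Ms W = mat (prod_list (take q Ms)) (prod_list (drop q Ms))
     (\<lambda>(i, j). W (split_idx (take q Ms) i @ split_idx (drop q Ms) j))"

(* Because the first index varies fastest, splitting and merging axes keeps the
   column-major enumeration of the entries. *)

definition reshape :: "nat \<Rightarrow> nat \<Rightarrow> real mat \<Rightarrow> real mat" where
  "reshape m n A = mat m n
     (\<lambda>(i, j). A $$ ((i + m * j) mod dim_row A, (i + m * j) div dim_row A))"

definition spd :: "nat \<Rightarrow> real mat \<Rightarrow> bool" where
  "spd n X \<longleftrightarrow> X \<in> carrier_mat n n \<and> transpose_mat X = X \<and>
     (\<forall>v \<in> carrier_vec n. v \<noteq> 0\<^sub>v n \<longrightarrow> v \<bullet> (X *\<^sub>v v) > 0)"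

definition cholesky_factor :: "nat \<Rightarrow> real mat \<Rightarrow> real mat \<Rightarrow> bool" where
  "cholesky_factor n X H \<longleftrightarrow> H \<in> carrier_mat n n \<and> upper_triangular H \<and>
     (\<forall>i < n. H $$ (i, i) > 0) \<and> transpose_mat H * H = X"

definition mat_inv :: "real mat \<Rightarrow> real mat" where
  "mat_inv A = the (mat_inverse A)"

definition frob_norm :: "real mat \<Rightarrow> real" where
  "frob_norm A = sqrt (\<Sum>i<dim_row A. \<Sum>j<dim_col A. (A $$ (i, j))\<^sup>2)"

definition wnorm_sq :: "real mat \<Rightarrow> real vec \<Rightarrow> real" where
  "wnorm_sq X v = v \<bullet> (X *\<^sub>v v)"

definition wnorm_mat_sq :: "real mat \<Rightarrow> real mat \<Rightarrow> real" where
  "wnorm_mat_sq X A = (\<Sum>j<dim_col A. wnorm_sq X (col A j))"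

definition weight_st :: "nat \<Rightarrow> real \<Rightarrow> real mat \<Rightarrow> real mat" where
  "weight_st Nt \<delta> X = diag_block_mat (replicate Nt (\<delta> \<cdot>\<^sub>m X))"

(* Thin singular value decomposition A = P * diag \<sigma> * Q^T. *)

definition is_svd :: "real mat \<Rightarrow> real mat \<Rightarrow> (nat \<Rightarrow> real) \<Rightarrow> real mat \<Rightarrow> bool" where
  "is_svd A P \<sigma> Q \<longleftrightarrow> (let p = min (dim_row A) (dim_col A) in
     P \<in> carrier_mat (dim_row A) p \<and> Q \<in> carrier_mat (dim_col A) p \<and>
     transpose_mat P * P = 1\<^sub>m p \<and> transpose_mat Q * Q = 1\<^sub>m p \<and>
     (\<forall>i < p. 0 \<le> \<sigma> i) \<and> (\<forall>i j. i \<le> j \<longrightarrow> j < p \<longrightarrow> \<sigma> j \<le> \<sigma> i) \<and>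
     A = P * mat_diag p \<sigma> * transpose_mat Q)"

definition take_cols :: "nat \<Rightarrow> real mat \<Rightarrow> real mat" where
  "take_cols k A = mat (dim_row A) k (\<lambda>(i, j). A $$ (i, j))"

definition truncated_svd :: "nat \<Rightarrow> real mat \<Rightarrow> real mat \<Rightarrow> real mat \<Rightarrow> bool" where
  "truncated_svd \<rho> A \<Phi> R \<longleftrightarrow> \<rho> \<le> min (dim_row A) (dim_col A) \<and>
     (\<exists>P \<sigma> Q. is_svd A P \<sigma> Q \<and> \<Phi> = take_cols \<rho> P \<and>
        R = mat_diag \<rho> \<sigma> * transpose_mat (take_cols \<rho> Q))"

(* TT-SVD of a tensor of shape Ms @ [N\<mu>]. Lists are indexed from 0, so that entry i
   of \<rho>s, Ts, \<Phi>s, Rs belongs to step i + 1; (1 # \<rho>s) ! i is then the rank with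
   number i, the rank with number 0 being 1. Singular vectors are not unique, hence
   a predicate and not a function. *)

definition tt_svd :: "tensor \<Rightarrow> nat list \<Rightarrow> nat \<Rightarrow> nat list \<Rightarrow>
    real mat list \<Rightarrow> real mat list \<Rightarrow> real mat list \<Rightarrow> bool" where
  "tt_svd W Ms N\<mu> \<rho>s Ts \<Phi>s Rs \<longleftrightarrow> (let k = length Ms in
     0 < k \<and> length \<rho>s = k \<and> length Ts = k \<and> length \<Phi>s = k \<and> length Rs = k \<and>
     Ts ! 0 = matricize 1 (Ms @ [N\<mu>]) W \<and>
     (\<forall>i < k. truncated_svd (\<rho>s ! i) (Ts ! i) (\<Phi>s ! i) (Rs ! i)) \<and>
     (\<forall>i. Suc i < k \<longrightarrow> Ts ! Suc i =
        reshape (\<rho>s ! i * Ms ! Suc i) (prod_list (drop (Suc (Suc i)) Ms) * N\<mu>) (Rs ! i)))"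

definition rel_error :: "real \<Rightarrow> real mat \<Rightarrow> real mat \<Rightarrow> real mat \<Rightarrow> bool" where
  "rel_error \<epsilon> T \<Phi> R \<longleftrightarrow>
     0 \<le> \<epsilon> \<and> (frob_norm (T - \<Phi> * R))\<^sup>2 = \<epsilon>\<^sup>2 * (frob_norm T)\<^sup>2"

(* Entry (a, n, b) of the three-dimensional array obtained from a core with r * M rows. *)

definition core_entry :: "nat \<Rightarrow> real mat \<Rightarrow> nat \<Rightarrow> nat \<Rightarrow> nat \<Rightarrow> real" where
  "core_entry r \<Phi> a n b = \<Phi> $$ (a + r * n, b)"

(* The sum runs over all rank indices \<alpha> 0, ..., \<alpha> k with \<alpha> k = b; \<alpha> 0 = 0 is forced
   because the rank with number 0 is 1. *)

definition contraction :: "nat list \<Rightarrow> nat list \<Rightarrow> real mat list \<Rightarrow> real mat" where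
  "contraction Ms \<rho>s \<Phi>s = (let k = length Ms in
     mat (prod_list Ms) ((1 # \<rho>s) ! k) (\<lambda>(n, b).
       \<Sum>\<alpha> \<in> {\<alpha> \<in> (\<Pi>\<^sub>E i \<in> {0..k}. {..<(1 # \<rho>s) ! i}). \<alpha> k = b}.
         \<Prod>i<k. core_entry ((1 # \<rho>s) ! i) (\<Phi>s ! i)
                  (\<alpha> i) (split_idx Ms n ! i) (\<alpha> (Suc i))))"

(* Multiplication by an Ns x Ns matrix along the spatial axis of a matrix whose rows
   are indexed by merged space-time indices. *)

definition apply_space :: "nat \<Rightarrow> nat \<Rightarrow> real mat \<Rightarrow> real mat \<Rightarrow> real mat" where
  "apply_space Ns Nt A \<Phi> =
     reshape (Ns * Nt) (dim_col \<Phi>) (A * reshape Ns (Nt * dim_col \<Phi>) \<Phi>)"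

(* Squared weighted error of U - c \<Phi> \<Phi>^T X U, summed over the columns. For the bases of
   interest \<Phi>^T X \<Phi> = \<delta> I, where \<delta> is the time-step size, so that c = 1 / \<delta> makes
   c \<Phi> \<Phi>^T X the X-orthogonal projection onto the column space of \<Phi>. *)

definition proj_error_sq :: "real \<Rightarrow> real mat \<Rightarrow> real mat \<Rightarrow> real mat \<Rightarrow> real" where
  "proj_error_sq c X \<Phi> U =
     (\<Sum>j<dim_col U. wnorm_sq X (col (U - c \<cdot>\<^sub>m (\<Phi> * transpose_mat \<Phi> * X * U)) j))"

end

theory Submission
  imports Defs "Jordan_Normal_Form.Determinant"
begin

text \<open>
  The partial contraction \<open>C\<^sub>i\<close> of the first \<open>i\<close> cores is \<open>(I \<otimes> C\<^sub>i\<^sub>-\<^sub>1) \<Phi>\<^sub>i\<close>. By induction it has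
  orthonormal columns, and the remainder \<open>R\<^sub>i\<close> is \<open>C\<^sub>i\<^sup>T\<close> times the \<open>i\<close>-th matricization of the
  tensor. Each step is an orthogonal projection and reshaping preserves the Frobenius norm, so
  the squared local errors telescope to the squared norm of the tensor minus that of the last
  remainder, which is exactly the squared error of the projection onto the columns of the full
  contraction. With \<open>G = I \<otimes> H\<close> the weight matrix is \<open>\<delta> G\<^sup>T G\<close>, so \<open>G\<close> carries the weighted
  problem to this unweighted one, up to the factor \<open>\<delta>\<close>.
\<close>

section \<open>Merged indices and reshaping\<close>

lemma merge_index_less:
  fixes i j m n :: nat
  assumes "i < m" "j < n"
  shows "i + m * j < m * n"
proof -
  have "i + m * j < m * Suc j" using assms by simp
  also have "\<dots> \<le> m * n" using assms by (intro mult_le_mono2) simp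
  finally show ?thesis .
qed

text \<open>Euclidean division by \<open>m\<close> inverts the merging of two indices. Sums over
  merged axes, in matrix products and in norms, are split this way.\<close>

lemma sum_merge_index:
  fixes f :: "nat \<Rightarrow> 'a::comm_monoid_add"
  shows "(\<Sum>k<m * n. f k) = (\<Sum>j<n. \<Sum>i<m. f (i + m * j))"
proof -
  have "(\<Sum>j<n. \<Sum>i<m. f (i + m * j)) = (\<Sum>(j, i)\<in>{..<n} \<times> {..<m}. f (i + m * j))"
    by (simp add: sum.cartesian_product)
  also have "\<dots> = (\<Sum>k<m * n. f k)"
  proof (rule sum.reindex_bij_witness[where i = "\<lambda>k. (k div m, k mod m)" and j = "\<lambda>(j, i). i + m * j"])
    fix k assume "k \<in> {..<m * n}"
    then have "k < n * m" "0 < m" by (auto simp: mult.commute intro: gr0I)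
    then show "(k div m, k mod m) \<in> {..<n} \<times> {..<m}"
      using less_mult_imp_div_less[of k n m] by simp
  qed (auto simp: merge_index_less)
  finally show ?thesis by simp
qed

lemma mult_mat_entry:
  fixes A B :: "'a::semiring_0 mat"
  assumes "A \<in> carrier_mat n m" "B \<in> carrier_mat m k" "i < n" "j < k"
  shows "(A * B) $$ (i, j) = (\<Sum>l<m. A $$ (i, l) * B $$ (l, j))"
  using assms by (simp add: scalar_prod_def atLeast0LessThan)

lemma reshape_carrier [simp, intro]: "reshape m n A \<in> carrier_mat m n"
  by (simp add: reshape_def)

lemma split_idx_append:
  "split_idx (Ms @ Ns) k = split_idx Ms k @ split_idx Ns (k div prod_list Ms)"
  by (induction Ms arbitrary: k) (auto simp: div_mult2_eq)

text \<open>Each digit of a mixed-radix expansion depends only on the residue modulo the product of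
  the radices up to it.\<close>

lemma split_idx_mod: "split_idx Ms (k mod prod_list Ms) = split_idx Ms k"
proof (induction Ms arbitrary: k)
  case (Cons M Ms)
  have "k mod (M * prod_list Ms) div M = k div M mod prod_list Ms"
    by (cases "M = 0") (auto simp: mod_mult2_eq)
  then show ?case using Cons by (simp add: mod_mod_cancel)
qed simp

lemma length_split_idx [simp]: "length (split_idx Ms k) = length Ms"
  by (induction Ms arbitrary: k) auto

lemma matricize_carrier [simp, intro]:
  "matricize q Ms W \<in> carrier_mat (prod_list (take q Ms)) (prod_list (drop q Ms))"
  by (simp add: matricize_def)

text \<open>All matricizations list the entries in one column-major order: dividing the linear index
  by the number of rows gives remainder \<open>i\<close> and quotient \<open>j\<close>.\<close>

lemma matricize_entry:
  assumes "i < prod_list (take q Ms)" "j < prod_list (drop q Ms)"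
  shows "matricize q Ms W $$ (i, j) = W (split_idx Ms (i + prod_list (take q Ms) * j))"
proof -
  let ?P = "prod_list (take q Ms)"
  have "split_idx Ms k = split_idx (take q Ms) k @ split_idx (drop q Ms) (k div ?P)" for k
    using split_idx_append[of "take q Ms" "drop q Ms" k] by simp
  moreover have "split_idx (take q Ms) (i + ?P * j) = split_idx (take q Ms) i"
    using split_idx_mod[of "take q Ms" "i + ?P * j"] assms by simp
  moreover have "(i + ?P * j) div ?P = j" using assms by (cases "?P = 0") auto
  ultimately show ?thesis using assms by (simp add: matricize_def)
qed

text \<open>Both sides read the tensor at the same linear index, which \<open>reshape\<close>
  preserves. As \<open>q\<close> and \<open>q'\<close> are arbitrary, axes move freely between rows
  and columns.\<close>

lemma reshape_matricize:
  assumes "0 < prod_list (take q Ms)"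
  shows "reshape (prod_list (take q' Ms)) (prod_list (drop q' Ms)) (matricize q Ms W) =
    matricize q' Ms W"
proof (rule eq_matI)
  let ?P = "prod_list (take q Ms)" and ?P' = "prod_list (take q' Ms)"
  fix i j assume "i < dim_row (matricize q' Ms W)" "j < dim_col (matricize q' Ms W)"
  then have i: "i < ?P'" and j: "j < prod_list (drop q' Ms)"
    by (simp_all add: matricize_def)
  \<comment> \<open>Both shapes have the same number of entries, so the linear index falls into a
    valid column of the old shape.\<close>
  have "?P' * prod_list (drop q' Ms) = prod_list Ms"
    by (metis append_take_drop_id prod_list.append)
  also have "\<dots> = prod_list (drop q Ms) * ?P"
    by (metis append_take_drop_id prod_list.append mult.commute)
  finally have "i + ?P' * j < prod_list (drop q Ms) * ?P"
    using merge_index_less[OF i j] by simp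
  then have "(i + ?P' * j) div ?P < prod_list (drop q Ms)"
    by (rule less_mult_imp_div_less)
  then show "reshape ?P' (prod_list (drop q' Ms)) (matricize q Ms W) $$ (i, j) =
      matricize q' Ms W $$ (i, j)"
    using i j assms matricize_carrier[of q Ms W]
    by (simp add: reshape_def matricize_entry carrier_matD[OF matricize_carrier])
qed (auto simp: matricize_def reshape_def)

section \<open>The Frobenius norm\<close>

text \<open>The trace of the Gram matrix: norm identities follow from matrix identities by comparing
  diagonals.\<close>

lemma frob_norm_sq: "(frob_norm A)\<^sup>2 = (\<Sum>j<dim_col A. (A\<^sup>T * A) $$ (j, j))"
proof -
  have "(frob_norm A)\<^sup>2 = (\<Sum>i<dim_row A. \<Sum>j<dim_col A. (A $$ (i, j))\<^sup>2)"
    by (simp add: frob_norm_def sum_nonneg)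
  also have "\<dots> = (\<Sum>j<dim_col A. \<Sum>i<dim_row A. (A $$ (i, j))\<^sup>2)"
    by (rule sum.swap)
  also have "\<dots> = (\<Sum>j<dim_col A. (A\<^sup>T * A) $$ (j, j))"
    by (intro sum.cong) (auto simp: scalar_prod_def atLeast0LessThan power2_eq_square)
  finally show ?thesis .
qed

text \<open>Both squared norms are the sum of one function \<open>g\<close> of the linear
  index.\<close>

lemma frob_norm_reshape:
  assumes "A \<in> carrier_mat r c" "r * c = m * n"
  shows "frob_norm (reshape m n A) = frob_norm A"
proof -
  define g where "g k = (A $$ (k mod r, k div r))\<^sup>2" for k
  have "(\<Sum>i<m. \<Sum>j<n. (reshape m n A $$ (i, j))\<^sup>2) = (\<Sum>k<m * n. g k)"
    unfolding sum_merge_index using assms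
    by (subst sum.swap) (auto simp: reshape_def g_def intro!: sum.cong)
  moreover have "(\<Sum>i<r. \<Sum>j<c. (A $$ (i, j))\<^sup>2) = (\<Sum>k<r * c. g k)"
    unfolding sum_merge_index
    by (subst sum.swap) (auto simp: g_def intro!: sum.cong)
  ultimately show ?thesis
    using assms by (simp add: frob_norm_def reshape_def)
qed

text \<open>Pythagoras for the orthogonal projection \<open>F * F\<^sup>T\<close>. It serves both
  for the local error of a TT-SVD step and for the global error of the full contraction.\<close>

lemma orthogonal_remainder:
  fixes A F :: "real mat"
  assumes A: "A \<in> carrier_mat m n" and F: "F \<in> carrier_mat m r" and FF: "F\<^sup>T * F = 1\<^sub>m r"
  shows "(frob_norm (A - F * (F\<^sup>T * A)))\<^sup>2 = (frob_norm A)\<^sup>2 - (frob_norm (F\<^sup>T * A))\<^sup>2"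
proof -
  define R where "R = F\<^sup>T * A"
  define D where "D = A - F * R"
  have R: "R \<in> carrier_mat r n" and D: "D \<in> carrier_mat m n"
    and FR: "F * R \<in> carrier_mat m n" and Ft: "F\<^sup>T \<in> carrier_mat r m"
    and At: "A\<^sup>T \<in> carrier_mat n m" and Rt: "R\<^sup>T \<in> carrier_mat n r"
    using A F by (auto simp: R_def D_def)
  \<comment> \<open>The residual \<open>D\<close> is orthogonal to the columns of \<open>F\<close>,
    which removes the cross term from \<open>D\<^sup>T * D\<close>.\<close>
  have "F\<^sup>T * D = F\<^sup>T * A - F\<^sup>T * (F * R)"
    unfolding D_def by (rule mult_minus_distrib_mat[OF Ft A FR])
  also have "F\<^sup>T * (F * R) = R"
    using assoc_mult_mat[OF Ft F R] FF R by simp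
  finally have FD: "F\<^sup>T * D = 0\<^sub>m r n"
    using R by (simp add: R_def[symmetric])
  have "D\<^sup>T * D = (A\<^sup>T - R\<^sup>T * F\<^sup>T) * D"
    unfolding D_def transpose_minus[OF A FR] transpose_mult[OF F R] by simp
  also have "\<dots> = A\<^sup>T * D - R\<^sup>T * F\<^sup>T * D"
    by (rule minus_mult_distrib_mat[OF At _ D]) (use Rt Ft in simp)
  also have "R\<^sup>T * F\<^sup>T * D = 0\<^sub>m n n"
    using assoc_mult_mat[OF Rt Ft D] FD Rt by simp
  also have "A\<^sup>T * D = A\<^sup>T * A - A\<^sup>T * (F * R)"
    unfolding D_def by (rule mult_minus_distrib_mat[OF At A FR])
  also have "A\<^sup>T * (F * R) = R\<^sup>T * R"
    using assoc_mult_mat[OF At F R] transpose_mult[OF Ft A] by (simp add: R_def)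
  finally have DD: "D\<^sup>T * D = A\<^sup>T * A - R\<^sup>T * R"
    using At A R Rt by auto
  have "(frob_norm D)\<^sup>2 = (frob_norm A)\<^sup>2 - (frob_norm R)\<^sup>2"
    unfolding frob_norm_sq DD using A D R
    by (simp add: sum_subtractf del: index_mult_mat(1))
  then show ?thesis by (simp add: D_def R_def)
qed

section \<open>Repeated diagonal blocks\<close>

text \<open>The Kronecker product of the identity of size \<open>M\<close> with \<open>B\<close>: as the first axis varies
  fastest, it acts as \<open>B\<close> on the first of two merged axes and as the identity on the second.\<close>

definition block_rep :: "nat \<Rightarrow> 'a::zero mat \<Rightarrow> 'a mat" where
  "block_rep M B = mat (dim_row B * M) (dim_col B * M) (\<lambda>(i, j).
     if i div dim_row B = j div dim_col B then B $$ (i mod dim_row B, j mod dim_col B) else 0)"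

lemma block_rep_carrier [intro]:
  "B \<in> carrier_mat p r \<Longrightarrow> block_rep M B \<in> carrier_mat (p * M) (r * M)"
  by (auto simp: block_rep_def)

lemma block_rep_dim [simp]:
  "dim_row (block_rep M B) = dim_row B * M" "dim_col (block_rep M B) = dim_col B * M"
  by (auto simp: block_rep_def)

lemma merged_row_split:
  fixes i p M :: nat
  assumes "i < p * M"
  shows "0 < p" "i mod p < p" "i div p < M"
proof -
  show "0 < p" using assms by (auto intro: gr0I)
  then show "i mod p < p" by simp
  show "i div p < M" using assms by (simp add: less_mult_imp_div_less mult.commute)
qed

lemma block_rep_entry:
  assumes "B \<in> carrier_mat p r" "i < p * M" "x < r" "y < M"
  shows "block_rep M B $$ (i, x + r * y) = (if i div p = y then B $$ (i mod p, x) else 0)"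
  using assms merge_index_less[of x r y M] by (auto simp: block_rep_def)

text \<open>Row \<open>i\<close> of the Kronecker product is supported on block
  \<open>i div p\<close>, so one block of rows of \<open>A\<close> contributes.\<close>

lemma block_rep_mult_entry:
  fixes B A :: "'a::semiring_0 mat"
  assumes B: "B \<in> carrier_mat p r" and A: "A \<in> carrier_mat (r * M) n"
    and i: "i < p * M" and j: "j < n"
  shows "(block_rep M B * A) $$ (i, j) = (\<Sum>x<r. B $$ (i mod p, x) * A $$ (x + r * (i div p), j))"
proof -
  have "(block_rep M B * A) $$ (i, j) = (\<Sum>l<r * M. block_rep M B $$ (i, l) * A $$ (l, j))"
    by (rule mult_mat_entry[OF block_rep_carrier[OF B] A i j])
  also have "\<dots> = (\<Sum>y<M. if y = i div p then
      (\<Sum>x<r. B $$ (i mod p, x) * A $$ (x + r * y, j)) else 0)"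
    unfolding sum_merge_index
    by (intro sum.cong refl) (auto simp: block_rep_entry[OF B i] intro!: sum.cong)
  also have "\<dots> = (\<Sum>x<r. B $$ (i mod p, x) * A $$ (x + r * (i div p), j))"
    using merged_row_split[OF i] by simp
  finally show ?thesis .
qed

text \<open>The mixed-product rule for Kronecker products with an identity factor.\<close>

lemma block_rep_mult:
  fixes B C :: "'a::semiring_0 mat"
  assumes B: "B \<in> carrier_mat p r" and C: "C \<in> carrier_mat r c"
  shows "block_rep M (B * C) = block_rep M B * block_rep M C"
proof (rule eq_matI)
  fix i j assume "i < dim_row (block_rep M B * block_rep M C)"
    and "j < dim_col (block_rep M B * block_rep M C)"
  then have i: "i < p * M" and j: "j < c * M" using B C by auto
  note i' = merged_row_split[OF i] and j' = merged_row_split[OF j]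
  have "(block_rep M B * block_rep M C) $$ (i, j) =
      (\<Sum>x<r. B $$ (i mod p, x) * block_rep M C $$ (x + r * (i div p), j))"
    by (rule block_rep_mult_entry[OF B block_rep_carrier[OF C] i j])
  also have "\<dots> = (\<Sum>x<r. B $$ (i mod p, x) * (if i div p = j div c then C $$ (x, j mod c) else 0))"
    using C i' j j' merge_index_less[of _ r "i div p" M]
    by (intro sum.cong) (auto simp: block_rep_def)
  also have "\<dots> = block_rep M (B * C) $$ (i, j)"
    using B C i j mult_mat_entry[OF B C i'(2) j'(2)]
    by (auto simp: block_rep_def simp del: index_mult_mat(1))
  finally show "block_rep M (B * C) $$ (i, j) = (block_rep M B * block_rep M C) $$ (i, j)" ..
qed (use B C in auto)

lemma block_rep_transpose: "block_rep M (B\<^sup>T) = (block_rep M B)\<^sup>T"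
proof (rule eq_matI)
  fix i j assume "i < dim_row ((block_rep M B)\<^sup>T)" "j < dim_col ((block_rep M B)\<^sup>T)"
  then have i: "i < dim_col B * M" and j: "j < dim_row B * M" by auto
  then show "block_rep M (B\<^sup>T) $$ (i, j) = (block_rep M B)\<^sup>T $$ (i, j)"
    using merged_row_split[OF i] merged_row_split[OF j] by (auto simp: block_rep_def)
qed auto

lemma block_rep_one: "block_rep M (1\<^sub>m n) = 1\<^sub>m (n * M)"
proof (rule eq_matI)
  fix i j assume "i < dim_row (1\<^sub>m (n * M))" "j < dim_col (1\<^sub>m (n * M))"
  then have i: "i < n * M" and j: "j < n * M" by auto
  have "i = j" if "i div n = j div n" "i mod n = j mod n"
    using that by (metis div_mult_mod_eq)
  then show "block_rep M (1\<^sub>m n) $$ (i, j) = 1\<^sub>m (n * M) $$ (i, j)"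
    using merged_row_split[OF i] merged_row_split[OF j] i j by (auto simp: block_rep_def)
qed auto

text \<open>Moving an axis of size \<open>M\<close> from the columns to the rows stacks
  \<open>M\<close> blocks of rows. \<open>B\<close> acts on the fastest index, hence on each block
  separately.\<close>

lemma reshape_mult:
  fixes B A :: "real mat"
  assumes B: "B \<in> carrier_mat p r" and A: "A \<in> carrier_mat r (M * n)"
  shows "reshape (p * M) n (B * A) = block_rep M B * reshape (r * M) n A"
proof (rule eq_matI)
  fix i j assume "i < dim_row (block_rep M B * reshape (r * M) n A)"
    and "j < dim_col (block_rep M B * reshape (r * M) n A)"
  then have i: "i < p * M" and j: "j < n" using B by (auto simp: reshape_def)
  note i' = merged_row_split[OF i]
  \<comment> \<open>The entry comes from row \<open>i mod p\<close> and column
    \<open>i div p + M * j\<close> of the product: the moved index merged with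
    \<open>j\<close>.\<close>
  have dv: "(i + p * M * j) div p = i div p + M * j"
    using i' by (simp add: mult.assoc)
  have "i div p + M * j < M * n" using merge_index_less[OF i'(3) j] .
  then have "reshape (p * M) n (B * A) $$ (i, j) =
      (\<Sum>x<r. B $$ (i mod p, x) * A $$ (x, i div p + M * j))"
    using i j A B i' mult_mat_entry[OF B A i'(2)] dv
    by (simp add: reshape_def mult.assoc add.commute del: index_mult_mat(1))
  also have "\<dots> = (\<Sum>x<r. B $$ (i mod p, x) * reshape (r * M) n A $$ (x + r * (i div p), j))"
  proof (intro sum.cong refl)
    fix x assume "x \<in> {..<r}"
    then have x: "x < r" by simp
    have e: "x + r * (i div p) + r * M * j = x + r * (i div p + M * j)"
      by (simp add: algebra_simps)
    have "reshape (r * M) n A $$ (x + r * (i div p), j) = A $$ (x, i div p + M * j)"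
      using A x j merge_index_less[OF x i'(3)]
      by (simp add: reshape_def e)
    then show "B $$ (i mod p, x) * A $$ (x, i div p + M * j) =
        B $$ (i mod p, x) * reshape (r * M) n A $$ (x + r * (i div p), j)" by simp
  qed
  also have "\<dots> = (block_rep M B * reshape (r * M) n A) $$ (i, j)"
    by (rule block_rep_mult_entry[OF B reshape_carrier i j, symmetric])
  finally show "reshape (p * M) n (B * A) $$ (i, j) =
      (block_rep M B * reshape (r * M) n A) $$ (i, j)" .
qed (use B in \<open>auto simp: reshape_def\<close>)

lemma reshape_reshape:
  assumes A: "A \<in> carrier_mat m n" and eq: "m * n = p * q"
  shows "reshape m n (reshape p q A) = A"
proof (rule eq_matI)
  fix i j assume "i < dim_row A" "j < dim_col A"
  then have i: "i < m" and j: "j < n" using A by auto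
  have k: "i + m * j < p * q" using merge_index_less[OF i j] eq by simp
  have "(i + m * j) mod p + p * ((i + m * j) div p) = i + m * j" by simp
  then show "reshape m n (reshape p q A) $$ (i, j) = A $$ (i, j)"
    using A i j merged_row_split[OF k] by (simp add: reshape_def)
qed (use A in \<open>auto simp: reshape_def\<close>)

text \<open>\<open>reshape_mult\<close> pulls the factor out, and the two remaining reshapings
  cancel.\<close>

lemma apply_space_eq:
  assumes "A \<in> carrier_mat Ns Ns" "\<Phi> \<in> carrier_mat (Ns * Nt) c"
  shows "apply_space Ns Nt A \<Phi> = block_rep Nt A * \<Phi>"
  using assms
  by (simp add: apply_space_def reshape_mult[of A Ns Ns _ Nt] reshape_reshape)

section \<open>The space-time weight matrix and its norm\<close>

lemma diag_block_mat_replicate: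
  assumes "A \<in> carrier_mat n n"
  shows "diag_block_mat (replicate M A) = block_rep M A"
proof (induction M)
  case 0
  show ?case by (rule eq_matI) auto
next
  case (Suc M)
  \<comment> \<open>Peeling off the leading block lowers the block numbers by one; \<open>dm\<close>
    says this with the quotient and remainder of \<open>k - n\<close>.\<close>
  have "four_block_mat A (0\<^sub>m n (n * M)) (0\<^sub>m (n * M) n) (block_rep M A) = block_rep (Suc M) A"
    (is "?L = ?R")
  proof (rule eq_matI)
    fix i j assume "i < dim_row ?R" "j < dim_col ?R"
    then have i: "i < n + n * M" and j: "j < n + n * M" using assms by auto
    have dm: "k div n = Suc ((k - n) div n) \<and> k mod n = (k - n) mod n"
      if "\<not> k < n" "k < n + n * M" for k
      using that le_div_geq[of n k] le_mod_geq[of n k] by (cases "n = 0") auto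
    show "?L $$ (i, j) = ?R $$ (i, j)"
      using assms i j dm[of i] dm[of j]
      by (auto simp: block_rep_def)
  qed (use assms in auto)
  then show ?case using Suc assms by (simp add: Let_def)
qed

lemma block_rep_smult: "block_rep M (c \<cdot>\<^sub>m B) = (c::'a::semiring_0) \<cdot>\<^sub>m block_rep M B"
proof (rule eq_matI)
  fix i j assume "i < dim_row (c \<cdot>\<^sub>m block_rep M B)" "j < dim_col (c \<cdot>\<^sub>m block_rep M B)"
  then have i: "i < dim_row B * M" and j: "j < dim_col B * M" by auto
  then show "block_rep M (c \<cdot>\<^sub>m B) $$ (i, j) = (c \<cdot>\<^sub>m block_rep M B) $$ (i, j)"
    using merged_row_split[OF i] merged_row_split[OF j] by (auto simp: block_rep_def)
qed auto

text \<open>\<open>block_rep\<close> respects scaling, transposes and products, so the factorization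
  of the spatial block lifts to the whole weight.\<close>

lemma weight_st_gram:
  fixes H :: "real mat"
  assumes "H \<in> carrier_mat n n"
  shows "weight_st M \<delta> (H\<^sup>T * H) = \<delta> \<cdot>\<^sub>m ((block_rep M H)\<^sup>T * block_rep M H)"
  using assms by (simp add: weight_st_def diag_block_mat_replicate[of _ n] block_rep_smult
      block_rep_mult[of _ n n _ n] block_rep_transpose)

text \<open>The squared weighted norm of column \<open>j\<close> is the diagonal entry
  \<open>(j, j)\<close> of \<open>D\<^sup>T * (X * D)\<close>, with \<open>X\<close> the weight
  matrix; this is \<delta> times a Gram matrix entry.\<close>

lemma weighted_norm_cols:
  fixes H D :: "real mat"
  assumes H: "H \<in> carrier_mat n n" and D: "D \<in> carrier_mat (n * M) c"
  shows "(\<Sum>j<c. wnorm_sq (weight_st M \<delta> (H\<^sup>T * H)) (col D j)) =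
    \<delta> * (frob_norm (block_rep M H * D))\<^sup>2"
proof -
  define G where "G = block_rep M H"
  define X where "X = weight_st M \<delta> (H\<^sup>T * H)"
  have G: "G \<in> carrier_mat (n * M) (n * M)" and Gt: "G\<^sup>T \<in> carrier_mat (n * M) (n * M)"
    using H by (auto simp: G_def)
  have X_eq: "X = \<delta> \<cdot>\<^sub>m (G\<^sup>T * G)"
    unfolding X_def G_def by (rule weight_st_gram[OF H])
  have "D\<^sup>T * (X * D) = \<delta> \<cdot>\<^sub>m (D\<^sup>T * (G\<^sup>T * G * D))"
    unfolding X_eq using G Gt D
    by (subst mult_smult_assoc_mat[of _ "n * M" "n * M" _ c])
      (auto intro!: mult_smult_distrib[of _ c "n * M" _ c])
  also have "D\<^sup>T * (G\<^sup>T * G * D) = (G * D)\<^sup>T * (G * D)"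
    using G Gt D by (simp add: transpose_mult[of G "n * M" "n * M" D c]
        assoc_mult_mat[of _ c "n * M" _ "n * M" _ c]
        assoc_mult_mat[of _ "n * M" "n * M" _ "n * M" _ c])
  finally have DXD: "D\<^sup>T * (X * D) = \<delta> \<cdot>\<^sub>m ((G * D)\<^sup>T * (G * D))" .
  have "wnorm_sq X (col D j) = \<delta> * ((G * D)\<^sup>T * (G * D)) $$ (j, j)" if "j < c" for j
  proof -
    have Xc: "X \<in> carrier_mat (n * M) (n * M)" using G Gt by (auto simp: X_eq)
    have "wnorm_sq X (col D j) = (D\<^sup>T * (X * D)) $$ (j, j)"
      using that D Xc by (simp add: wnorm_sq_def mult_mat_vec_def col_mult2[of X "n * M" "n * M" D c])
    then show ?thesis using that D by (simp add: DXD del: index_mult_mat(1))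
  qed
  then show ?thesis
    using D unfolding frob_norm_sq G_def[symmetric] X_def[symmetric]
    by (simp add: sum_distrib_left del: index_mult_mat(1))
qed

text \<open>A triangular matrix with positive diagonal has nonzero determinant, so
  \<open>mat_inverse\<close> succeeds and \<open>mat_inv\<close> is a true inverse.\<close>

lemma cholesky_mat_inv:
  assumes "cholesky_factor n X H"
  shows "mat_inv H \<in> carrier_mat n n" "H * mat_inv H = 1\<^sub>m n"
proof -
  have H: "H \<in> carrier_mat n n" using assms by (simp add: cholesky_factor_def)
  have "0 \<notin> set (diag_mat H)"
    using assms by (fastforce simp: cholesky_factor_def diag_mat_def)
  then have "prod_list (diag_mat H) \<noteq> 0" by simp
  then have "det H \<noteq> 0"
    using det_upper_triangular[of H n] assms by (simp add: cholesky_factor_def)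
  then have "H \<in> Units (ring_mat TYPE(real) n ())" by (rule det_non_zero_imp_unit[OF H])
  then obtain B where "mat_inverse H = Some B"
    using mat_inverse(1)[OF H] by fastforce
  then show "mat_inv H \<in> carrier_mat n n" "H * mat_inv H = 1\<^sub>m n"
    using mat_inverse(2)[OF H] by (auto simp: mat_inv_def)
qed

section \<open>The TT-SVD\<close>

text \<open>Reduces a truncated SVD to an isometry and the coordinates of \<open>A\<close> with
  respect to its columns, the form in which the error analysis uses it.\<close>

lemma truncated_svd_orthogonal:
  assumes A: "A \<in> carrier_mat m n" and "truncated_svd \<rho> A \<Phi> R"
  shows "\<Phi> \<in> carrier_mat m \<rho>" "\<Phi>\<^sup>T * \<Phi> = 1\<^sub>m \<rho>" "R = \<Phi>\<^sup>T * A"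
proof -
  define p where "p = min m n"
  obtain P \<sigma> Q where \<rho>: "\<rho> \<le> p" and P: "P \<in> carrier_mat m p" and Q: "Q \<in> carrier_mat n p"
    and PP: "P\<^sup>T * P = 1\<^sub>m p" and A_eq: "A = P * mat_diag p \<sigma> * Q\<^sup>T"
    and \<Phi>: "\<Phi> = take_cols \<rho> P" and R: "R = mat_diag \<rho> \<sigma> * (take_cols \<rho> Q)\<^sup>T"
    using assms by (auto simp: truncated_svd_def is_svd_def Let_def p_def)
  \<comment> \<open>The first \<rho> columns of the identity: truncation becomes right
    multiplication by \<open>E\<close>, so associativity handles it.\<close>
  define E :: "real mat" where "E = mat p \<rho> (\<lambda>(i, j). if i = j then 1 else 0)"
  have E: "E \<in> carrier_mat p \<rho>" and Et: "E\<^sup>T \<in> carrier_mat \<rho> p" by (auto simp: E_def)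
  have take: "take_cols \<rho> Z = Z * E" if "Z \<in> carrier_mat k p" for Z k
  proof (rule eq_matI)
    fix i j assume "i < dim_row (Z * E)" "j < dim_col (Z * E)"
    then have i: "i < k" and j: "j < \<rho>" using that E by auto
    have "(Z * E) $$ (i, j) = (\<Sum>l<p. Z $$ (i, l) * E $$ (l, j))"
      by (rule mult_mat_entry[OF that E i j])
    also have "\<dots> = (\<Sum>l<p. if l = j then Z $$ (i, l) else 0)"
      using j by (intro sum.cong) (auto simp: E_def)
    also have "\<dots> = Z $$ (i, j)" using j \<rho> by simp
    finally show "take_cols \<rho> Z $$ (i, j) = (Z * E) $$ (i, j)"
      using i j that by (simp add: take_cols_def del: index_mult_mat(1))
  qed (use that E in \<open>auto simp: take_cols_def\<close>)
  have \<Phi>_eq: "\<Phi> = P * E" unfolding \<Phi> by (rule take[OF P])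
  have Pt: "P\<^sup>T \<in> carrier_mat p m" and Qt: "Q\<^sup>T \<in> carrier_mat p n" using P Q by auto
  have D: "mat_diag p \<sigma> \<in> carrier_mat p p" by simp
  have DQ: "mat_diag p \<sigma> * Q\<^sup>T \<in> carrier_mat p n" using D Qt by (rule mult_carrier_mat)
  show "\<Phi> \<in> carrier_mat m \<rho>" using P E by (simp add: \<Phi>_eq)
  have PtPhi: "\<Phi>\<^sup>T * (P * Z) = E\<^sup>T * Z" if "Z \<in> carrier_mat p c" for Z c
  proof -
    have "\<Phi>\<^sup>T * (P * Z) = E\<^sup>T * (P\<^sup>T * (P * Z))"
      unfolding \<Phi>_eq transpose_mult[OF P E]
      by (rule assoc_mult_mat[OF Et Pt]) (use P that in auto)
    also have "P\<^sup>T * (P * Z) = Z"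
      using assoc_mult_mat[OF Pt P that] PP that by simp
    finally show ?thesis .
  qed
  have EE: "E\<^sup>T * E = 1\<^sub>m \<rho>"
    unfolding take[OF Et, symmetric] using \<rho> by (auto simp: take_cols_def E_def)
  show "\<Phi>\<^sup>T * \<Phi> = 1\<^sub>m \<rho>"
    using PtPhi[OF E] EE by (simp add: \<Phi>_eq)
  have "A = P * (mat_diag p \<sigma> * Q\<^sup>T)"
    unfolding A_eq by (rule assoc_mult_mat[OF P D Qt])
  then have "\<Phi>\<^sup>T * A = E\<^sup>T * (mat_diag p \<sigma> * Q\<^sup>T)" using PtPhi[OF DQ] by simp
  also have "\<dots> = E\<^sup>T * mat_diag p \<sigma> * Q\<^sup>T"
    by (rule assoc_mult_mat[OF Et D Qt, symmetric])
  \<comment> \<open>Keeping the first \<rho> rows commutes with diagonal scaling once the diagonal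
    is cut to size \<rho>.\<close>
  also have "E\<^sup>T * mat_diag p \<sigma> = mat_diag \<rho> \<sigma> * E\<^sup>T"
    unfolding mat_diag_mult_left[OF Et] mat_diag_mult_right[OF Et]
    by (rule cong_mat) (auto simp: E_def)
  also have "mat_diag \<rho> \<sigma> * E\<^sup>T * Q\<^sup>T = R"
    unfolding R take[OF Q] transpose_mult[OF Q E]
    by (rule assoc_mult_mat[OF mat_diag_dim Et Qt])
  finally show "R = \<Phi>\<^sup>T * A" ..
qed

section \<open>Contraction of the cores\<close>

lemma contraction_carrier [simp, intro]:
  "contraction Ms \<rho>s \<Phi>s \<in> carrier_mat (prod_list Ms) ((1 # \<rho>s) ! length Ms)"
  by (simp add: contraction_def Let_def)

text \<open>Start of the recursion: the rank with number 0 is 1, so there is a single index tuple,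
  and a product over no cores is 1.\<close>

lemma contraction_Nil: "contraction [] [] [] = 1\<^sub>m 1"
proof -
  have "{\<alpha> \<in> (\<Pi>\<^sub>E i\<in>{0..0::nat}. {..<[1::nat] ! i}). \<alpha> 0 = (0::nat)} = {restrict (\<lambda>_. 0) {0}}"
    by (auto simp: PiE_iff extensional_def restrict_def fun_eq_iff)
  then have "contraction [] [] [] = mat 1 1 (\<lambda>_. 1)"
    unfolding contraction_def Let_def by (intro cong_mat) (auto simp: less_Suc_eq)
  also have "\<dots> = 1\<^sub>m 1" by (auto simp: one_mat_def intro!: cong_mat)
  finally show ?thesis .
qed

text \<open>With the last index pinned to \<open>b\<close> and ignored by \<open>g\<close>, a tuple
  is determined by its indices up to \<open>k\<close>. Grouping by the value at \<open>k\<close>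
  exposes the column index of the shorter contraction.\<close>

lemma sum_PiE_last:
  fixes g :: "(nat \<Rightarrow> nat) \<Rightarrow> 'b::comm_monoid_add"
  assumes "b \<in> B (Suc k)" and fin: "\<And>i. i \<le> k \<Longrightarrow> finite (B i)"
    and g: "\<And>\<alpha> \<beta>. (\<And>i. i \<le> k \<Longrightarrow> \<alpha> i = \<beta> i) \<Longrightarrow> g \<alpha> = g \<beta>"
  shows "(\<Sum>\<alpha> \<in> {\<alpha> \<in> (\<Pi>\<^sub>E i\<in>{0..Suc k}. B i). \<alpha> (Suc k) = b}. g \<alpha>) =
    (\<Sum>a\<in>B k. \<Sum>\<alpha> \<in> {\<alpha> \<in> (\<Pi>\<^sub>E i\<in>{0..k}. B i). \<alpha> k = a}. g \<alpha>)"
proof -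
  let ?S = "\<Pi>\<^sub>E i\<in>{0..k}. B i"
  have finS: "finite ?S" by (rule finite_PiE) (auto intro: fin)
  have "(\<Sum>\<alpha> \<in> {\<alpha> \<in> (\<Pi>\<^sub>E i\<in>{0..Suc k}. B i). \<alpha> (Suc k) = b}. g \<alpha>) = sum g ?S"
  proof (rule sum.reindex_bij_witness[where j = "\<lambda>\<alpha>. restrict \<alpha> {0..k}"
        and i = "\<lambda>\<alpha>. \<alpha>(Suc k := b)"])
    fix \<alpha> assume \<alpha>: "\<alpha> \<in> {\<alpha> \<in> (\<Pi>\<^sub>E i\<in>{0..Suc k}. B i). \<alpha> (Suc k) = b}"
    then show "(restrict \<alpha> {0..k})(Suc k := b) = \<alpha>"
      by (auto simp: fun_eq_iff PiE_iff extensional_def)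
    show "restrict \<alpha> {0..k} \<in> ?S" using \<alpha> by (auto simp: PiE_iff)
    show "g (restrict \<alpha> {0..k}) = g \<alpha>" by (rule g) auto
  next
    fix \<alpha> assume \<alpha>: "\<alpha> \<in> ?S"
    then show "restrict (\<alpha>(Suc k := b)) {0..k} = \<alpha>"
      by (auto simp: fun_eq_iff PiE_iff extensional_def)
    show "\<alpha>(Suc k := b) \<in> {\<alpha> \<in> (\<Pi>\<^sub>E i\<in>{0..Suc k}. B i). \<alpha> (Suc k) = b}"
      using \<alpha> assms(1) by (auto simp: PiE_iff extensional_def)
  qed
  also have "\<dots> = (\<Sum>a\<in>B k. \<Sum>\<alpha> \<in> {\<alpha> \<in> ?S. \<alpha> k = a}. g \<alpha>)"
    by (rule sum.group[symmetric]) (auto simp: finS fin)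
  finally show ?thesis .
qed

text \<open>Summing over the rank index shared by the last core and its predecessors is a matrix
  product, and the row order \<open>a + r * n\<close> of a core matches the block order of
  \<open>block_rep\<close>.\<close>

lemma contraction_snoc:
  assumes len: "length \<rho>s = length Ms" "length \<Phi>s = length Ms"
    and \<Phi>: "\<Phi> \<in> carrier_mat ((1 # \<rho>s) ! length Ms * M) \<rho>"
  shows "contraction (Ms @ [M]) (\<rho>s @ [\<rho>]) (\<Phi>s @ [\<Phi>]) = block_rep M (contraction Ms \<rho>s \<Phi>s) * \<Phi>"
proof (rule eq_matI)
  let ?k = "length Ms" and ?P = "prod_list Ms" and ?C = "contraction Ms \<rho>s \<Phi>s"
  let ?r = "\<lambda>i. (1 # \<rho>s) ! i" and ?r' = "\<lambda>i. (1 # \<rho>s @ [\<rho>]) ! i"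
  fix n b assume "n < dim_row (block_rep M ?C * \<Phi>)" "b < dim_col (block_rep M ?C * \<Phi>)"
  then have n: "n < ?P * M" and b: "b < \<rho>"
    using \<Phi> by (simp_all add: contraction_def Let_def)
  note n' = merged_row_split[OF n]
  have r': "?r' i = ?r i" if "i \<le> ?k" for i
    using that len by (cases i) (auto simp: nth_append)
  have r'_last: "?r' (Suc ?k) = \<rho>" using len by (simp add: nth_append)
  have split: "split_idx (Ms @ [M]) n = split_idx Ms (n mod ?P) @ [n div ?P]"
    using n' by (simp add: split_idx_append split_idx_mod)
  \<comment> \<open>\<open>w\<close> collects the factors of the earlier cores, \<open>h\<close>
    adds that of the last. Neither reads \<open>\<alpha> (Suc ?k)\<close>, as
    \<open>sum_PiE_last\<close> requires; \<open>h\<close> has \<open>b\<close> in its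
    place.\<close>
  define w where "w \<alpha> = (\<Prod>i<?k. core_entry (?r i) (\<Phi>s ! i) (\<alpha> i) (split_idx Ms (n mod ?P) ! i) (\<alpha> (Suc i)))"
    for \<alpha> :: "nat \<Rightarrow> nat"
  define h where "h \<alpha> = w \<alpha> * \<Phi> $$ (\<alpha> ?k + ?r ?k * (n div ?P), b)" for \<alpha>
  have w_cong: "w \<alpha> = w \<beta>" if "\<And>i. i \<le> ?k \<Longrightarrow> \<alpha> i = \<beta> i" for \<alpha> \<beta>
    unfolding w_def using that by (intro prod.cong) auto
  have "contraction (Ms @ [M]) (\<rho>s @ [\<rho>]) (\<Phi>s @ [\<Phi>]) $$ (n, b) =
      (\<Sum>\<alpha> \<in> {\<alpha> \<in> (\<Pi>\<^sub>E i\<in>{0..Suc ?k}. {..<?r' i}). \<alpha> (Suc ?k) = b}.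
        \<Prod>i<Suc ?k. core_entry (?r' i) ((\<Phi>s @ [\<Phi>]) ! i) (\<alpha> i)
          (split_idx (Ms @ [M]) n ! i) (\<alpha> (Suc i)))"
    using n b r'_last by (simp add: contraction_def Let_def)
  also have "\<dots> = (\<Sum>\<alpha> \<in> {\<alpha> \<in> (\<Pi>\<^sub>E i\<in>{0..Suc ?k}. {..<?r' i}). \<alpha> (Suc ?k) = b}. h \<alpha>)"
  proof (rule sum.cong[OF refl])
    fix \<alpha> assume "\<alpha> \<in> {\<alpha> \<in> (\<Pi>\<^sub>E i\<in>{0..Suc ?k}. {..<?r' i}). \<alpha> (Suc ?k) = b}"
    then have "\<alpha> (Suc ?k) = b" by simp
    moreover have "(\<Prod>i<?k. core_entry (?r' i) ((\<Phi>s @ [\<Phi>]) ! i) (\<alpha> i)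
          (split_idx (Ms @ [M]) n ! i) (\<alpha> (Suc i))) = w \<alpha>"
      unfolding w_def split using len
      by (intro prod.cong refl) (simp add: nth_append r'[unfolded One_nat_def])
    ultimately show "(\<Prod>i<Suc ?k. core_entry (?r' i) ((\<Phi>s @ [\<Phi>]) ! i) (\<alpha> i)
          (split_idx (Ms @ [M]) n ! i) (\<alpha> (Suc i))) = h \<alpha>"
      using len r'[of ?k] by (simp add: h_def split nth_append core_entry_def)
  qed
  also have "\<dots> = (\<Sum>a<?r' ?k. \<Sum>\<alpha> \<in> {\<alpha> \<in> (\<Pi>\<^sub>E i\<in>{0..?k}. {..<?r' i}). \<alpha> ?k = a}. h \<alpha>)"
  proof (rule sum_PiE_last)
    fix \<alpha> \<beta> :: "nat \<Rightarrow> nat" assume "\<And>i. i \<le> ?k \<Longrightarrow> \<alpha> i = \<beta> i"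
    then show "h \<alpha> = h \<beta>" using w_cong[of \<alpha> \<beta>] by (simp add: h_def)
  qed (use b r'_last in auto)
  also have "(\<Pi>\<^sub>E i\<in>{0..?k}. {..<?r' i}) = (\<Pi>\<^sub>E i\<in>{0..?k}. {..<?r i})"
    by (rule PiE_cong) (simp add: r'[unfolded One_nat_def])
  also have "(\<Sum>a<?r' ?k. \<Sum>\<alpha> \<in> {\<alpha> \<in> (\<Pi>\<^sub>E i\<in>{0..?k}. {..<?r i}). \<alpha> ?k = a}. h \<alpha>) =
      (\<Sum>a<?r ?k. ?C $$ (n mod ?P, a) * \<Phi> $$ (a + ?r ?k * (n div ?P), b))"
  proof (rule sum.cong)
    fix a assume "a \<in> {..<?r ?k}"
    then have C: "?C $$ (n mod ?P, a) = (\<Sum>\<alpha> \<in> {\<alpha> \<in> (\<Pi>\<^sub>E i\<in>{0..?k}. {..<?r i}). \<alpha> ?k = a}. w \<alpha>)"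
      using n'(2) by (simp add: contraction_def Let_def w_def)
    show "(\<Sum>\<alpha> \<in> {\<alpha> \<in> (\<Pi>\<^sub>E i\<in>{0..?k}. {..<?r i}). \<alpha> ?k = a}. h \<alpha>) =
        ?C $$ (n mod ?P, a) * \<Phi> $$ (a + ?r ?k * (n div ?P), b)"
      unfolding C sum_distrib_right by (rule sum.cong) (simp_all add: h_def)
  qed (use r'[of ?k] in simp)
  also have "\<dots> = (block_rep M ?C * \<Phi>) $$ (n, b)"
    by (rule block_rep_mult_entry[OF contraction_carrier \<Phi> n b, symmetric])
  finally show "contraction (Ms @ [M]) (\<rho>s @ [\<rho>]) (\<Phi>s @ [\<Phi>]) $$ (n, b) =
      (block_rep M ?C * \<Phi>) $$ (n, b)" .
next
  show "dim_row (contraction (Ms @ [M]) (\<rho>s @ [\<rho>]) (\<Phi>s @ [\<Phi>])) =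
      dim_row (block_rep M (contraction Ms \<rho>s \<Phi>s) * \<Phi>)"
    by (simp add: carrier_matD(1)[OF contraction_carrier])
  show "dim_col (contraction (Ms @ [M]) (\<rho>s @ [\<rho>]) (\<Phi>s @ [\<Phi>])) =
      dim_col (block_rep M (contraction Ms \<rho>s \<Phi>s) * \<Phi>)"
    using \<Phi> len by (simp add: carrier_matD(2)[OF contraction_carrier] nth_append)
qed

lemma contraction_single:
  assumes "\<Phi> \<in> carrier_mat M \<rho>"
  shows "contraction [M] [\<rho>] [\<Phi>] = \<Phi>"
proof -
  have "contraction [M] [\<rho>] [\<Phi>] = block_rep M (contraction [] [] []) * \<Phi>"
    using contraction_snoc[of "[]" "[]" "[]" \<Phi> M \<rho>] assms by simp
  also have "\<dots> = 1\<^sub>m (1 * M) * \<Phi>" unfolding contraction_Nil block_rep_one ..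
  also have "\<dots> = \<Phi>" using assms by simp
  finally show ?thesis .
qed

text \<open>A composition of isometries: \<open>block_rep M C\<close> inherits orthonormal columns
  from \<open>C\<close>.\<close>

lemma block_rep_isometry:
  fixes C \<Phi> :: "real mat"
  assumes C: "C \<in> carrier_mat p r" and CC: "C\<^sup>T * C = 1\<^sub>m r"
    and \<Phi>: "\<Phi> \<in> carrier_mat (r * M) \<rho>" and \<Phi>\<Phi>: "\<Phi>\<^sup>T * \<Phi> = 1\<^sub>m \<rho>"
  shows "(block_rep M C * \<Phi>)\<^sup>T * (block_rep M C * \<Phi>) = 1\<^sub>m \<rho>"
proof -
  define B where "B = block_rep M C"
  have B: "B \<in> carrier_mat (p * M) (r * M)" unfolding B_def by (rule block_rep_carrier[OF C])
  have Ct: "C\<^sup>T \<in> carrier_mat r p" and Bt: "B\<^sup>T \<in> carrier_mat (r * M) (p * M)"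
    and \<Phi>t: "\<Phi>\<^sup>T \<in> carrier_mat \<rho> (r * M)" and B\<Phi>: "B * \<Phi> \<in> carrier_mat (p * M) \<rho>"
    using C B \<Phi> by auto
  have "B\<^sup>T * B = 1\<^sub>m (r * M)"
    unfolding B_def block_rep_transpose[symmetric] block_rep_mult[OF Ct C, symmetric] CC
    by (rule block_rep_one)
  then have "B\<^sup>T * (B * \<Phi>) = \<Phi>" using assoc_mult_mat[OF Bt B \<Phi>] \<Phi> by simp
  moreover have "(B * \<Phi>)\<^sup>T * (B * \<Phi>) = \<Phi>\<^sup>T * (B\<^sup>T * (B * \<Phi>))"
    unfolding transpose_mult[OF B \<Phi>] by (rule assoc_mult_mat[OF \<Phi>t Bt B\<Phi>])
  ultimately show ?thesis using \<Phi>\<Phi> by (simp add: B_def)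
qed

text \<open>\<open>S\<close> is the list of remainders preceded by the whole tensor as a single row,
  so \<open>S ! i\<close> enters step \<open>i\<close> and \<open>S ! Suc i\<close> is
  \<open>Rs ! i\<close>. The first unfolding is thus a reshaping of \<open>S ! i\<close> like all
  others.\<close>

lemma tt_svd_step:
  assumes tt: "tt_svd W Ms N \<rho>s Ts \<Phi>s Rs" and i: "i < length Ms"
  defines "S \<equiv> matricize 0 (Ms @ [N]) W # Rs"
  assumes S: "S ! i \<in> carrier_mat ((1 # \<rho>s) ! i) (prod_list (drop i Ms) * N)"
  shows "Ts ! i = reshape ((1 # \<rho>s) ! i * Ms ! i) (prod_list (drop (Suc i) Ms) * N) (S ! i)"
    and "frob_norm (Ts ! i) = frob_norm (S ! i)"
    and "\<Phi>s ! i \<in> carrier_mat ((1 # \<rho>s) ! i * Ms ! i) (\<rho>s ! i)"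
    and "(\<Phi>s ! i)\<^sup>T * \<Phi>s ! i = 1\<^sub>m (\<rho>s ! i)"
    and "Rs ! i = (\<Phi>s ! i)\<^sup>T * Ts ! i"
    and "(frob_norm (Ts ! i - \<Phi>s ! i * Rs ! i))\<^sup>2 = (frob_norm (S ! i))\<^sup>2 - (frob_norm (Rs ! i))\<^sup>2"
    and "Rs ! i \<in> carrier_mat (\<rho>s ! i) (prod_list (drop (Suc i) Ms) * N)"
proof -
  note tt' = tt[unfolded tt_svd_def Let_def]
  let ?m = "(1 # \<rho>s) ! i * Ms ! i" and ?n = "prod_list (drop (Suc i) Ms) * N"
  show T: "Ts ! i = reshape ?m ?n (S ! i)"
  proof (cases i)
    case 0
    then obtain M Ms' where Ms: "Ms = M # Ms'" using i by (cases Ms) auto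
    have "Ts ! 0 = matricize 1 (Ms @ [N]) W" using tt' by simp
    also have "\<dots> = reshape (prod_list (take 1 (Ms @ [N]))) (prod_list (drop 1 (Ms @ [N])))
        (matricize 0 (Ms @ [N]) W)"
      by (rule reshape_matricize[symmetric]) simp
    finally show ?thesis using 0 Ms by (simp add: S_def)
  next
    case (Suc l)
    then show ?thesis using tt' i by (simp add: S_def)
  qed
  then have Tc: "Ts ! i \<in> carrier_mat ?m ?n" by simp
  \<comment> \<open>Axis \<open>i\<close> passes from the columns to the rows, which leaves the
    number of entries unchanged.\<close>
  have "drop i Ms = Ms ! i # drop (Suc i) Ms" using i by (rule Cons_nth_drop_Suc[symmetric])
  then show frob: "frob_norm (Ts ! i) = frob_norm (S ! i)"
    unfolding T by (intro frob_norm_reshape[OF S]) simp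
  have svd: "truncated_svd (\<rho>s ! i) (Ts ! i) (\<Phi>s ! i) (Rs ! i)" using tt' i by simp
  note orth = truncated_svd_orthogonal[OF Tc svd]
  show "\<Phi>s ! i \<in> carrier_mat ?m (\<rho>s ! i)" "(\<Phi>s ! i)\<^sup>T * \<Phi>s ! i = 1\<^sub>m (\<rho>s ! i)"
    "Rs ! i = (\<Phi>s ! i)\<^sup>T * Ts ! i" by (rule orth)+
  then show "Rs ! i \<in> carrier_mat (\<rho>s ! i) ?n" using Tc by simp
  show "(frob_norm (Ts ! i - \<Phi>s ! i * Rs ! i))\<^sup>2 = (frob_norm (S ! i))\<^sup>2 - (frob_norm (Rs ! i))\<^sup>2"
    using orthogonal_remainder[OF Tc orth(1,2)] by (simp add: orth(3)[symmetric] frob)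
qed

text \<open>The step errors so far account exactly for the norm lost. The shape of
  \<open>S ! i\<close> belongs to the invariant because \<open>tt_svd_step\<close> asks for
  it.\<close>

lemma tt_svd_partial:
  assumes tt: "tt_svd W Ms N \<rho>s Ts \<Phi>s Rs" and pos: "\<forall>M\<in>set Ms. 0 < M"
    and "i \<le> length Ms"
  defines "S \<equiv> matricize 0 (Ms @ [N]) W # Rs"
    and "C \<equiv> \<lambda>i. contraction (take i Ms) (take i \<rho>s) (take i \<Phi>s)"
  shows "S ! i \<in> carrier_mat ((1 # \<rho>s) ! i) (prod_list (drop i Ms) * N) \<and>
    C i \<in> carrier_mat (prod_list (take i Ms)) ((1 # \<rho>s) ! i) \<and>
    (C i)\<^sup>T * C i = 1\<^sub>m ((1 # \<rho>s) ! i) \<and>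
    S ! i = (C i)\<^sup>T * matricize i (Ms @ [N]) W \<and>
    (\<Sum>j<i. (frob_norm (Ts ! j - \<Phi>s ! j * Rs ! j))\<^sup>2) = (frob_norm (S ! 0))\<^sup>2 - (frob_norm (S ! i))\<^sup>2"
  using assms(3)
proof (induction i)
  case 0
  have "matricize 0 (Ms @ [N]) W \<in> carrier_mat 1 (prod_list Ms * N)"
    using matricize_carrier[of 0 "Ms @ [N]" W] by simp
  then show ?case by (auto simp: S_def C_def contraction_Nil)
next
  case (Suc i)
  then have i: "i < length Ms" by simp
  let ?r = "(1 # \<rho>s) ! i" and ?M = "Ms ! i" and ?n = "prod_list (drop (Suc i) Ms) * N"
  let ?P = "prod_list (take i Ms)"
  from Suc have S: "S ! i \<in> carrier_mat ?r (prod_list (drop i Ms) * N)"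
    and Cc: "C i \<in> carrier_mat ?P ?r" and CC: "(C i)\<^sup>T * C i = 1\<^sub>m ?r"
    and SC: "S ! i = (C i)\<^sup>T * matricize i (Ms @ [N]) W"
    and sm: "(\<Sum>j<i. (frob_norm (Ts ! j - \<Phi>s ! j * Rs ! j))\<^sup>2) = (frob_norm (S ! 0))\<^sup>2 - (frob_norm (S ! i))\<^sup>2"
    by auto
  note step = tt_svd_step[OF tt i S[unfolded S_def], folded S_def]
  have len: "length \<rho>s = length Ms" "length \<Phi>s = length Ms"
    using tt by (auto simp: tt_svd_def Let_def)
  have rank: "(1 # take i \<rho>s) ! length (take i Ms) = ?r"
    using i len by (cases i) auto
  have C_Suc: "C (Suc i) = block_rep ?M (C i) * \<Phi>s ! i"
    using contraction_snoc[of "take i \<rho>s" "take i Ms" "take i \<Phi>s" "\<Phi>s ! i" ?M "\<rho>s ! i"]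
      i len step(3) unfolding C_def rank by (simp add: take_Suc_conv_app_nth)
  have P_Suc: "prod_list (take (Suc i) Ms) = ?P * ?M"
    using i by (simp add: take_Suc_conv_app_nth)
  have drop_i: "drop i Ms = ?M # drop (Suc i) Ms" using i by (rule Cons_nth_drop_Suc[symmetric])
  have Ppos: "0 < ?P" using pos by (fastforce dest: in_set_takeD intro: gr0I)
  have A: "matricize i (Ms @ [N]) W \<in> carrier_mat ?P (?M * ?n)"
    using matricize_carrier[of i "Ms @ [N]" W] i drop_i by (simp add: mult.assoc)
  have A_Suc: "matricize (Suc i) (Ms @ [N]) W = reshape (?P * ?M) ?n (matricize i (Ms @ [N]) W)"
    using reshape_matricize[of i "Ms @ [N]" "Suc i" W] Ppos i P_Suc by simp
  have Ct: "(C i)\<^sup>T \<in> carrier_mat ?r ?P" using Cc by simp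
  \<comment> \<open>Reshaping \<open>(C i)\<^sup>T\<close> times a matricization yields the block
    version of the factor times the next matricization.\<close>
  have "Ts ! i = block_rep ?M ((C i)\<^sup>T) * matricize (Suc i) (Ms @ [N]) W"
    unfolding step(1) SC A_Suc by (rule reshape_mult[OF Ct A])
  then have "Rs ! i = (\<Phi>s ! i)\<^sup>T * ((block_rep ?M (C i))\<^sup>T * matricize (Suc i) (Ms @ [N]) W)"
    using step(5) by (simp add: block_rep_transpose)
  also have "\<dots> = (C (Suc i))\<^sup>T * matricize (Suc i) (Ms @ [N]) W"
    unfolding C_Suc A_Suc transpose_mult[OF block_rep_carrier[OF Cc] step(3)]
    using block_rep_carrier[OF Cc, of ?M] step(3)
    by (intro assoc_mult_mat[symmetric, of _ "\<rho>s ! i" "?r * ?M" _ "?P * ?M" _ ?n]) auto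
  finally have "Rs ! i = (C (Suc i))\<^sup>T * matricize (Suc i) (Ms @ [N]) W" .
  moreover have "C (Suc i) \<in> carrier_mat (?P * ?M) (\<rho>s ! i)"
    unfolding C_Suc using block_rep_carrier[OF Cc] step(3) by (rule mult_carrier_mat)
  moreover have "(C (Suc i))\<^sup>T * C (Suc i) = 1\<^sub>m (\<rho>s ! i)"
    unfolding C_Suc by (rule block_rep_isometry[OF Cc CC step(3,4)])
  \<comment> \<open>Each step error is the difference of consecutive squared norms, so the sum
    telescopes.\<close>
  ultimately show ?case using step(6,7) sm P_Suc by (simp add: S_def)
qed

text \<open>At the last index the remainder is \<open>C\<^sup>T * A\<close>, so the telescoped sum
  and Pythagoras for the projection give the same difference, with equality.\<close>

lemma tt_svd_error:
  fixes Ms :: "nat list"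
  assumes tt: "tt_svd W Ms N \<rho>s Ts \<Phi>s Rs" and pos: "\<forall>M\<in>set Ms. 0 < M"
  defines "A \<equiv> matricize (length Ms) (Ms @ [N]) W" and "C \<equiv> contraction Ms \<rho>s \<Phi>s"
  shows "C \<in> carrier_mat (prod_list Ms) ((1 # \<rho>s) ! length Ms)"
    and "(frob_norm (A - C * (C\<^sup>T * A)))\<^sup>2 =
      (\<Sum>i<length Ms. (frob_norm (Ts ! i - \<Phi>s ! i * Rs ! i))\<^sup>2)"
    and "\<And>i. i < length Ms \<Longrightarrow> (frob_norm (Ts ! i))\<^sup>2 \<le> (frob_norm A)\<^sup>2"
proof -
  define S where "S = matricize 0 (Ms @ [N]) W # Rs"
  let ?k = "length Ms"
  have len: "length \<rho>s = ?k" "length \<Phi>s = ?k"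
    using tt by (auto simp: tt_svd_def Let_def)
  note part = tt_svd_partial[OF tt pos, folded S_def]
  have A: "A \<in> carrier_mat (prod_list Ms) N"
    using matricize_carrier[of ?k "Ms @ [N]" W] by (simp add: A_def)
  have "A = reshape (prod_list Ms) N (matricize 0 (Ms @ [N]) W)"
    using reshape_matricize[of 0 "Ms @ [N]" ?k W] by (simp add: A_def)
  moreover have "frob_norm (reshape (prod_list Ms) N (matricize 0 (Ms @ [N]) W)) =
      frob_norm (matricize 0 (Ms @ [N]) W)"
    using matricize_carrier[of 0 "Ms @ [N]" W]
    by (intro frob_norm_reshape[of _ 1 "prod_list Ms * N"]) auto
  ultimately have normA: "frob_norm A = frob_norm (S ! 0)" by (simp add: S_def)
  show C: "C \<in> carrier_mat (prod_list Ms) ((1 # \<rho>s) ! ?k)" unfolding C_def by (rule contraction_carrier)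
  have rem: "C\<^sup>T * A = S ! ?k" using part[of ?k] len by (simp add: C_def A_def)
  have "(frob_norm (A - C * (C\<^sup>T * A)))\<^sup>2 = (frob_norm A)\<^sup>2 - (frob_norm (C\<^sup>T * A))\<^sup>2"
    using part[of ?k] len by (intro orthogonal_remainder[OF A C]) (simp add: C_def)
  then show "(frob_norm (A - C * (C\<^sup>T * A)))\<^sup>2 =
      (\<Sum>i<?k. (frob_norm (Ts ! i - \<Phi>s ! i * Rs ! i))\<^sup>2)"
    using part[of ?k] normA by (simp add: rem)
  show "(frob_norm (Ts ! i))\<^sup>2 \<le> (frob_norm A)\<^sup>2" if "i < ?k" for i
  proof -
    have Si: "S ! i \<in> carrier_mat ((1 # \<rho>s) ! i) (prod_list (drop i Ms) * N)"
      using that by (intro conjunct1[OF part]) simp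
    have "frob_norm (Ts ! i) = frob_norm (S ! i)"
      using tt_svd_step(2)[OF tt that Si[unfolded S_def]] by (simp add: S_def)
    \<comment> \<open>This sum is the drop of the squared norm from \<open>S ! 0\<close> to
      \<open>S ! i\<close>, so no unfolding exceeds \<open>A\<close> in norm.\<close>
    moreover have "0 \<le> (\<Sum>j<i. (frob_norm (Ts ! j - \<Phi>s ! j * Rs ! j))\<^sup>2)"
      by (intro sum_nonneg) simp
    ultimately show ?thesis using part[of i] that normA by simp
  qed
qed

section \<open>The weighted error\<close>

text \<open>Multiplication by \<open>block_rep M H\<close> takes \<open>V\<close> to
  \<open>A\<close> and \<Phi> to \<open>F\<close>. The \<delta> inside the projection cancels
  against \<open>1 / \<delta>\<close>; the one that remains comes from the weighted norm.\<close>

lemma weighted_proj_error: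
  fixes H V F :: "real mat"
  assumes H: "cholesky_factor n X H" and \<delta>: "0 < \<delta>"
    and V: "V \<in> carrier_mat (n * M) c" and F: "F \<in> carrier_mat (n * M) r"
  defines "\<Phi> \<equiv> block_rep M (mat_inv H) * F" and "A \<equiv> block_rep M H * V"
  shows "proj_error_sq (1 / \<delta>) (weight_st M \<delta> X) \<Phi> V = \<delta> * (frob_norm (A - F * (F\<^sup>T * A)))\<^sup>2"
    and "wnorm_mat_sq (weight_st M \<delta> X) V = \<delta> * (frob_norm A)\<^sup>2"
proof -
  have Hc: "H \<in> carrier_mat n n" and X_eq: "X = H\<^sup>T * H"
    using H by (auto simp: cholesky_factor_def)
  note norm = weighted_norm_cols[OF Hc, of _ M, folded X_eq]
  show "wnorm_mat_sq (weight_st M \<delta> X) V = \<delta> * (frob_norm A)\<^sup>2"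
    using norm[OF V] V by (simp add: wnorm_mat_sq_def A_def)
  define G K where "G = block_rep M H" and "K = block_rep M (mat_inv H)"
  let ?m = "n * M"
  have Hinv: "mat_inv H \<in> carrier_mat n n" using cholesky_mat_inv[OF H] by simp
  have G: "G \<in> carrier_mat ?m ?m" and K: "K \<in> carrier_mat ?m ?m"
    unfolding G_def K_def using Hc Hinv by auto
  have GK: "G * K = 1\<^sub>m ?m"
    unfolding G_def K_def block_rep_mult[OF Hc Hinv, symmetric]
    by (simp add: cholesky_mat_inv(2)[OF H] block_rep_one)
  have Gt: "G\<^sup>T \<in> carrier_mat ?m ?m" and Kt: "K\<^sup>T \<in> carrier_mat ?m ?m"
    and Ft: "F\<^sup>T \<in> carrier_mat r ?m" using G K F by auto
  \<comment> \<open>Transposing \<open>G * K = 1\<close> gives the order of factors that cancels in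
    \<open>F\<^sup>T * (K\<^sup>T * (G\<^sup>T * A))\<close>.\<close>
  have KG: "K\<^sup>T * G\<^sup>T = 1\<^sub>m ?m"
    unfolding transpose_mult[OF G K, symmetric] GK by simp
  have A: "A \<in> carrier_mat ?m c" and A_eq: "A = G * V" using G V by (auto simp: A_def G_def)
  define Y where "Y = F * (F\<^sup>T * A)"
  have FA: "F\<^sup>T * A \<in> carrier_mat r c" and Y: "Y \<in> carrier_mat ?m c"
    using F A by (auto simp: Y_def)
  have \<Phi>_eq: "\<Phi> = K * F" and \<Phi>: "\<Phi> \<in> carrier_mat ?m r" and \<Phi>t: "\<Phi>\<^sup>T \<in> carrier_mat r ?m"
    using K F by (auto simp: \<Phi>_def K_def)
  let ?X = "weight_st M \<delta> X"
  have X_st: "?X = \<delta> \<cdot>\<^sub>m (G\<^sup>T * G)"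
    unfolding X_eq G_def by (rule weight_st_gram[OF Hc])
  have XV: "?X * V = \<delta> \<cdot>\<^sub>m (G\<^sup>T * A)"
    unfolding X_st A_eq using G Gt V
    by (subst mult_smult_assoc_mat[of _ ?m ?m _ c]) auto
  have Xc: "?X \<in> carrier_mat ?m ?m" using G Gt by (simp add: X_st)
  have GA: "G\<^sup>T * A \<in> carrier_mat ?m c" using Gt A by (rule mult_carrier_mat)
  have \<Phi>GA: "\<Phi>\<^sup>T * (G\<^sup>T * A) = F\<^sup>T * A"
  proof -
    have "\<Phi>\<^sup>T * (G\<^sup>T * A) = F\<^sup>T * (K\<^sup>T * (G\<^sup>T * A))"
      unfolding \<Phi>_eq transpose_mult[OF K F] by (rule assoc_mult_mat[OF Ft Kt GA])
    also have "K\<^sup>T * (G\<^sup>T * A) = A"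
      using assoc_mult_mat[OF Kt Gt A] KG A by simp
    finally show ?thesis .
  qed
  have "\<Phi> * \<Phi>\<^sup>T * ?X * V = \<Phi> * (\<Phi>\<^sup>T * (?X * V))"
    using \<Phi> \<Phi>t Xc V by (simp add: assoc_mult_mat[of _ ?m ?m ?X ?m V c]
        assoc_mult_mat[of _ ?m r _ ?m _ c])
  also have "\<dots> = \<delta> \<cdot>\<^sub>m (\<Phi> * (\<Phi>\<^sup>T * (G\<^sup>T * A)))"
    unfolding XV mult_smult_distrib[OF \<Phi>t GA]
    by (rule mult_smult_distrib[OF \<Phi>]) (use \<Phi>t GA in auto)
  also have "\<Phi>\<^sup>T * (G\<^sup>T * A) = F\<^sup>T * A" by (rule \<Phi>GA)
  also have "\<Phi> * (F\<^sup>T * A) = K * Y"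
    unfolding \<Phi>_eq Y_def by (rule assoc_mult_mat[OF K F FA])
  finally have proj: "(1 / \<delta>) \<cdot>\<^sub>m (\<Phi> * \<Phi>\<^sup>T * ?X * V) = K * Y"
    using \<delta> K Y by (auto simp del: index_mult_mat(1) intro!: eq_matI)
  have KY: "K * Y \<in> carrier_mat ?m c" using K Y by (rule mult_carrier_mat)
  \<comment> \<open>\<open>G\<close> takes the residual of \<open>V\<close> to that of
    \<open>A\<close>.\<close>
  have "G * (V - K * Y) = A - G * (K * Y)"
    unfolding A_eq by (rule mult_minus_distrib_mat[OF G V KY])
  also have "G * (K * Y) = Y" using assoc_mult_mat[OF G K Y] GK Y by simp
  finally have res: "G * (V - K * Y) = A - Y" .
  have VKY: "V - K * Y \<in> carrier_mat ?m c" by (rule minus_carrier_mat[OF KY])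
  show "proj_error_sq (1 / \<delta>) ?X \<Phi> V = \<delta> * (frob_norm (A - F * (F\<^sup>T * A)))\<^sup>2"
    using norm[OF VKY] V unfolding Y_def[symmetric]
    by (simp add: proj_error_sq_def proj G_def[symmetric] res)
qed

text \<open>Since \<open>\<Phi>\<^sup>T * Xst * \<Phi>\<close> is \<delta> times the identity,
  \<open>\<Phi> * \<Phi>\<^sup>T * Xst\<close> is a projection after division by \<delta>. Hence the
  literal product appears for \<delta> = 1 and the factor \<open>1 / \<delta>\<close> for every step
  size. The rescaling by \<open>H\<close> leaves \<delta> out, so \<open>S\<close> acquires a factor
  \<delta>.\<close>

theorem theorem2:
  fixes Ns Nt N\<mu> :: nat and \<delta> :: real and X H :: "real mat" and U U' :: tensor
  defines "Ust \<equiv> matricize 2 [Ns, Nt, N\<mu>] U"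
    and "Xst \<equiv> weight_st Nt \<delta> X"
  assumes pos: "0 < Ns" "0 < Nt" "0 < N\<mu>"
    and delta: "0 < \<delta>"
    and X: "spd Ns X"
    and H: "cholesky_factor Ns X H"
    and U': "matricize 1 [Ns, Nt, N\<mu>] U' = H * matricize 1 [Ns, Nt, N\<mu>] U"
  shows "(\<forall>rs rt Ts Tt \<Phi>s \<Phi>t Rs Rt \<epsilon>s \<epsilon>t.
            tt_svd U' [Ns, Nt] N\<mu> [rs, rt] [Ts, Tt] [\<Phi>s, \<Phi>t] [Rs, Rt] \<longrightarrow>
            rel_error \<epsilon>s Ts \<Phi>s Rs \<longrightarrow> rel_error \<epsilon>t Tt \<Phi>t Rt \<longrightarrow>
            (let \<Phi> = contraction [Ns, Nt] [rs, rt] [mat_inv H * \<Phi>s, \<Phi>t] in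
               (\<delta> = 1 \<longrightarrow>
                  (\<Sum>j<N\<mu>. wnorm_sq Xst (col (Ust - \<Phi> * transpose_mat \<Phi> * Xst * Ust) j))
                    \<le> (\<epsilon>s\<^sup>2 + \<epsilon>t\<^sup>2) * wnorm_mat_sq Xst Ust) \<and>
               proj_error_sq (1 / \<delta>) Xst \<Phi> Ust \<le> (\<epsilon>s\<^sup>2 + \<epsilon>t\<^sup>2) * wnorm_mat_sq Xst Ust))
       \<and> (\<forall>d Ms W \<rho>s Ts \<Phi>s Rs \<epsilon>s.
            1 \<le> d \<longrightarrow> length Ms = d \<longrightarrow> prod_list Ms = Ns \<longrightarrow>
            matricize d (Ms @ [Nt, N\<mu>]) W = matricize 1 [Ns, Nt, N\<mu>] U' \<longrightarrow>
            tt_svd W (Ms @ [Nt]) N\<mu> \<rho>s Ts \<Phi>s Rs \<longrightarrow>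
            length \<epsilon>s = d + 1 \<longrightarrow>
            (\<forall>i < d + 1. rel_error (\<epsilon>s ! i) (Ts ! i) (\<Phi>s ! i) (Rs ! i)) \<longrightarrow>
            (let \<Phi> = apply_space Ns Nt (mat_inv H) (contraction (Ms @ [Nt]) \<rho>s \<Phi>s);
                 S = (\<Sum>i<d + 1. (\<epsilon>s ! i)\<^sup>2 * (frob_norm (Ts ! i))\<^sup>2);
                 \<epsilon> = (SUP i\<in>{..<d + 1}. \<epsilon>s ! i) in
               (\<delta> = 1 \<longrightarrow>
                  (\<Sum>j<N\<mu>. wnorm_sq Xst (col (Ust - \<Phi> * transpose_mat \<Phi> * Xst * Ust) j)) \<le> S \<and>
                  S \<le> \<epsilon>\<^sup>2 * real (d + 1) * wnorm_mat_sq Xst Ust) \<and>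
               proj_error_sq (1 / \<delta>) Xst \<Phi> Ust \<le> \<delta> * S \<and>
               \<delta> * S \<le> \<epsilon>\<^sup>2 * real (d + 1) * wnorm_mat_sq Xst Ust))"
proof -
  have Ust: "Ust \<in> carrier_mat (Ns * Nt) N\<mu>"
    using matricize_carrier[of 2 "[Ns, Nt, N\<mu>]" U] by (simp add: Ust_def)
  have Hc: "H \<in> carrier_mat Ns Ns" using H by (simp add: cholesky_factor_def)
  define A where "A = block_rep Nt H * Ust"
  have mat1: "matricize 1 [Ns, Nt, N\<mu>] V \<in> carrier_mat Ns (Nt * N\<mu>)" for V
    using matricize_carrier[of 1 "[Ns, Nt, N\<mu>]" V] by simp
  have mat2: "reshape (Ns * Nt) N\<mu> (matricize 1 [Ns, Nt, N\<mu>] V) = matricize 2 [Ns, Nt, N\<mu>] V" for V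
    using reshape_matricize[of 1 "[Ns, Nt, N\<mu>]" 2 V] pos by (simp add: numeral_2_eq_2)
  \<comment> \<open>Rescaling by \<open>H\<close> along space is \<open>block_rep Nt H\<close> on
    merged space-time rows, so \<open>A\<close> is a matricization of \<open>U'\<close>.\<close>
  have A_U': "reshape (Ns * Nt) N\<mu> (matricize 1 [Ns, Nt, N\<mu>] U') = A"
    unfolding U' A_def Ust_def mat2[of U, symmetric] by (rule reshape_mult[OF Hc mat1])
  have inv: "mat_inv H \<in> carrier_mat Ns Ns" using cholesky_mat_inv[OF H] by simp
  note err = weighted_proj_error[OF H delta Ust, folded A_def Xst_def]
  have unit: "(\<Sum>j<N\<mu>. wnorm_sq Xst (col (Ust - \<Phi> * \<Phi>\<^sup>T * Xst * Ust) j)) =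
      proj_error_sq (1 / \<delta>) Xst \<Phi> Ust" if "\<delta> = 1" for \<Phi>
  proof -
    have "1 \<cdot>\<^sub>m B = B" for B :: "real mat" by (rule eq_matI) auto
    then show ?thesis using that Ust by (simp add: proj_error_sq_def)
  qed
  have part1: "proj_error_sq (1 / \<delta>) Xst (contraction [Ns, Nt] [rs, rt] [mat_inv H * \<Phi>s, \<Phi>t]) Ust
      \<le> (\<epsilon>s\<^sup>2 + \<epsilon>t\<^sup>2) * wnorm_mat_sq Xst Ust"
    if tt: "tt_svd U' [Ns, Nt] N\<mu> [rs, rt] [Ts, Tt] [\<Phi>s, \<Phi>t] [Rs, Rt]"
      and es: "rel_error \<epsilon>s Ts \<Phi>s Rs" and et: "rel_error \<epsilon>t Tt \<Phi>t Rt"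
    for rs rt Ts Tt \<Phi>s \<Phi>t Rs Rt \<epsilon>s \<epsilon>t
  proof -
    let ?C = "contraction [Ns, Nt] [rs, rt] [\<Phi>s, \<Phi>t]"
    have posM: "\<forall>M\<in>set [Ns, Nt]. 0 < M" using pos by auto
    have Ts: "Ts = matricize 1 [Ns, Nt, N\<mu>] U'"
      and svd_s: "truncated_svd rs Ts \<Phi>s Rs" and svd_t: "truncated_svd rt Tt \<Phi>t Rt"
      and Tt: "Tt = reshape (rs * Nt) N\<mu> Rs"
      using tt by (auto simp: tt_svd_def Let_def All_less_Suc)
    have \<Phi>s: "\<Phi>s \<in> carrier_mat Ns rs"
      using truncated_svd_orthogonal(1)[OF _ svd_s] mat1 by (auto simp: Ts)
    have \<Phi>t: "\<Phi>t \<in> carrier_mat (rs * Nt) rt"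
      using truncated_svd_orthogonal(1)[OF _ svd_t] by (auto simp: Tt)
    have two: "contraction [Ns, Nt] [rs, rt] [\<Psi>, \<Phi>t] = block_rep Nt \<Psi> * \<Phi>t"
      if "\<Psi> \<in> carrier_mat Ns rs" for \<Psi>
      using contraction_snoc[of "[rs]" "[Ns]" "[\<Psi>]" \<Phi>t Nt rt] contraction_single[OF that] \<Phi>t by simp
    \<comment> \<open>Applying the inverse to the first core alone equals applying it along the
      spatial axis of the whole contraction, as \<open>block_rep\<close> is multiplicative.\<close>
    have \<Phi>: "contraction [Ns, Nt] [rs, rt] [mat_inv H * \<Phi>s, \<Phi>t] = block_rep Nt (mat_inv H) * ?C"
      unfolding two[OF \<Phi>s] two[OF mult_carrier_mat[OF inv \<Phi>s]] block_rep_mult[OF inv \<Phi>s]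
      by (rule assoc_mult_mat[OF block_rep_carrier[OF inv] block_rep_carrier[OF \<Phi>s] \<Phi>t])
    have C: "?C \<in> carrier_mat (Ns * Nt) rt" using contraction_carrier[of "[Ns, Nt]" "[rs, rt]"] by simp
    have "matricize (length [Ns, Nt]) ([Ns, Nt] @ [N\<mu>]) U' = A"
      using A_U' mat2 by (simp add: numeral_2_eq_2)
    note tte = tt_svd_error(2,3)[OF tt posM, unfolded this]
    have "(frob_norm (A - ?C * (?C\<^sup>T * A)))\<^sup>2 = \<epsilon>s\<^sup>2 * (frob_norm Ts)\<^sup>2 + \<epsilon>t\<^sup>2 * (frob_norm Tt)\<^sup>2"
      using tte(1) es et by (simp add: rel_error_def)
    also have "\<dots> \<le> \<epsilon>s\<^sup>2 * (frob_norm A)\<^sup>2 + \<epsilon>t\<^sup>2 * (frob_norm A)\<^sup>2"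
      using tte(2)[of 0] tte(2)[of 1] by (intro add_mono mult_left_mono) auto
    finally have "(frob_norm (A - ?C * (?C\<^sup>T * A)))\<^sup>2 \<le> (\<epsilon>s\<^sup>2 + \<epsilon>t\<^sup>2) * (frob_norm A)\<^sup>2"
      by (simp add: algebra_simps)
    then show ?thesis
      unfolding \<Phi> err(1)[OF C] err(2)[OF C] using delta
      by (simp add: mult.left_commute)
  qed
  have part2: "proj_error_sq (1 / \<delta>) Xst (apply_space Ns Nt (mat_inv H) (contraction (Ms @ [Nt]) \<rho>s \<Phi>s)) Ust
        \<le> \<delta> * (\<Sum>i<d + 1. (\<epsilon>s ! i)\<^sup>2 * (frob_norm (Ts ! i))\<^sup>2) \<and>
      \<delta> * (\<Sum>i<d + 1. (\<epsilon>s ! i)\<^sup>2 * (frob_norm (Ts ! i))\<^sup>2)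
        \<le> (SUP i\<in>{..<d + 1}. \<epsilon>s ! i)\<^sup>2 * real (d + 1) * wnorm_mat_sq Xst Ust"
    if d: "length Ms = d" and Ms: "prod_list Ms = Ns"
      and W: "matricize d (Ms @ [Nt, N\<mu>]) W = matricize 1 [Ns, Nt, N\<mu>] U'"
      and tt: "tt_svd W (Ms @ [Nt]) N\<mu> \<rho>s Ts \<Phi>s Rs"
      and rel: "\<forall>i < d + 1. rel_error (\<epsilon>s ! i) (Ts ! i) (\<Phi>s ! i) (Rs ! i)"
    for d Ms W \<rho>s Ts \<Phi>s Rs and \<epsilon>s :: "real list"
  proof -
    let ?C = "contraction (Ms @ [Nt]) \<rho>s \<Phi>s"
    have "0 \<notin> set Ms" using pos Ms by (auto simp: prod_list_zero_iff[symmetric])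
    then have posM: "\<forall>M\<in>set (Ms @ [Nt]). 0 < M" using pos by (auto intro: gr0I)
    \<comment> \<open>Splitting the spatial axis keeps the linear order, so merging all
      \<open>Suc d\<close> space and time axes of \<open>W\<close> gives the same
      \<open>A\<close>.\<close>
    have AW: "matricize (length (Ms @ [Nt])) ((Ms @ [Nt]) @ [N\<mu>]) W = A"
      using reshape_matricize[of d "Ms @ [Nt, N\<mu>]" "Suc d" W] d Ms pos W A_U' by simp
    note tte = tt_svd_error[OF tt posM, unfolded AW]
    have C: "?C \<in> carrier_mat (Ns * Nt) ((1 # \<rho>s) ! Suc d)" using tte(1) d Ms by simp
    have sum_eq: "(frob_norm (A - ?C * (?C\<^sup>T * A)))\<^sup>2 =
        (\<Sum>i<d + 1. (\<epsilon>s ! i)\<^sup>2 * (frob_norm (Ts ! i))\<^sup>2)"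
      using tte(2) d rel by (simp add: rel_error_def)
    let ?e = "SUP i\<in>{..<d + 1}. \<epsilon>s ! i"
    have "(\<epsilon>s ! i)\<^sup>2 * (frob_norm (Ts ! i))\<^sup>2 \<le> ?e\<^sup>2 * (frob_norm A)\<^sup>2" if "i \<in> {..<d + 1}" for i
    proof (rule mult_mono)
      \<comment> \<open>The supremum of finitely many errors bounds each of them; nonnegativity
        allows squaring.\<close>
      have "\<epsilon>s ! i \<le> ?e" using that by (intro cSUP_upper) auto
      moreover have "0 \<le> \<epsilon>s ! i" using rel that by (simp add: rel_error_def)
      ultimately show "(\<epsilon>s ! i)\<^sup>2 \<le> ?e\<^sup>2" by (rule power_mono)
      show "(frob_norm (Ts ! i))\<^sup>2 \<le> (frob_norm A)\<^sup>2" using tte(3)[of i] that d by simp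
    qed auto
    then have "(\<Sum>i<d + 1. (\<epsilon>s ! i)\<^sup>2 * (frob_norm (Ts ! i))\<^sup>2) \<le> real (d + 1) * (?e\<^sup>2 * (frob_norm A)\<^sup>2)"
      using sum_mono[of "{..<d + 1}" "\<lambda>i. (\<epsilon>s ! i)\<^sup>2 * (frob_norm (Ts ! i))\<^sup>2"
          "\<lambda>_. ?e\<^sup>2 * (frob_norm A)\<^sup>2"]
      by (simp only: sum_constant card_lessThan)
    from mult_left_mono[OF this less_imp_le[OF delta]]
    have "\<delta> * (\<Sum>i<d + 1. (\<epsilon>s ! i)\<^sup>2 * (frob_norm (Ts ! i))\<^sup>2)
        \<le> ?e\<^sup>2 * real (d + 1) * wnorm_mat_sq Xst Ust"
      unfolding err(2)[OF C] by (simp only: mult_ac)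
    then show ?thesis
      unfolding apply_space_eq[OF inv C] err(1)[OF C] sum_eq by simp
  qed
  show ?thesis
    unfolding Let_def using part1 part2 unit by auto
qed

end
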